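(* Let $g>1$ be an integer, and let $f(X)\in\mathbb{Z}[X]$ be a polynomial of degree $\deg f\ge 3$ with a positive leading coefficient and no multiple roots in its splitting field. Put $u(n)=f(g^n)$ for $n\ge 1$. Let $\alpha>0$ be a real number for which $$ \left|\left\{\ell\le z:\ \ell \text{ is prime and } P^+(\ell-1)\ge \ell^{\alpha}\right\}\right|\gg \frac{z}{\log z} $$ for all sufficiently large $z$, where the implied constant depends only on $\alpha$. Then for $M\in\mathbb{Z}$, integers $N\ge1$ and $S\ge 1$, $$ \mathcal{Q}_u(M,N;S)\le\left(SN^{1/(1+\alpha)}+S^{1-1/(4\alpha)}N^{1/(2\alpha)}\right)N^{o(1)} $$ as $N\to\infty$, where the function of $N$ implied by $o(1)$ depends only on $f$, $g$ and $\alpha$.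
   Context: $P^+(k)$ denotes the largest prime divisor of an integer $k\ge 2$. For $M,N,s\in\mathbb{Z}$ with $N\ge1$ and $s$ squarefree, $Q_u(M,N;s)$ denotes the number of integers $n\in[M+1,M+N]$ (with $n\ge 1$, where $u(n)$ is defined) for which $\mathbb{Q}(\sqrt{u(n)})=\mathbb{Q}(\sqrt{s})$. Put $$\mathcal{Q}_u(M,N;S)=\sum_{\substack{1\le s\le S\\ s\text{ squarefree}}}Q_u(M,N;s).$$ The notation $B\gg A$ means $|A|\le cB$ for some constant $c>0$ (the implied constant). *)

theory Defs
  imports
    "HOL-Analysis.Analysis"
    "HOL-Computational_Algebra.Computational_Algebra"
    "HOL-Algebra.Generated_Fields"
    "HOL-Algebra.Algebraic_Closure_Type"
begin

text \<open>Only meaningful for \<open>k \<ge> 2\<close>: for smaller \<open>k\<close> the set of prime factors is empty.\<close>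
definition largest_prime_factor :: "nat \<Rightarrow> nat" where
  "largest_prime_factor k = Max (prime_factors k)"

text \<open>The field \<open>\<rat>(\<surd>a)\<close>, as the subfield of the complex numbers generated by \<open>\<surd>a\<close>
  (a generated subfield contains \<open>1\<close>, hence all of \<open>\<rat>\<close>). Thus \<open>\<rat>(\<surd>0) = \<rat>(\<surd>1) = \<rat>\<close>.\<close>
definition quad_field :: "int \<Rightarrow> complex set" where
  "quad_field a = generate_field ring_of_type_algebra {csqrt (of_int a)}"

definition Q_count :: "(nat \<Rightarrow> int) \<Rightarrow> int \<Rightarrow> nat \<Rightarrow> int \<Rightarrow> nat" where
  "Q_count u M N s =
     card {n::nat. n \<ge> 1 \<and> int n \<in> {M + 1..M + int N} \<and> quad_field (u n) = quad_field s}"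

definition Q_total :: "(nat \<Rightarrow> int) \<Rightarrow> int \<Rightarrow> nat \<Rightarrow> nat \<Rightarrow> nat" where
  "Q_total u M N S = (\<Sum>s | s \<in> {1..int S} \<and> squarefree s. Q_count u M N s)"

lemma inv_complex_ring:
  fixes x :: complex
  assumes "x \<noteq> 0"
  shows "inv\<^bsub>ring_of_type_algebra\<^esub> x = inverse x"
proof -
  interpret C: field "ring_of_type_algebra :: complex ring"
    by (rule field_from_type_algebra)
  show ?thesis
    using assms by (intro C.comm_inv_char) (auto simp: ring_of_type_algebra_def)
qed

lemma uminus_complex_ring:
  fixes x :: complex
  shows "\<ominus>\<^bsub>ring_of_type_algebra\<^esub> x = - x"
proof -
  interpret C: field "ring_of_type_algebra :: complex ring"
    by (rule field_from_type_algebra)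
  show ?thesis
    by (intro C.minus_equality) (auto simp: ring_of_type_algebra_def)
qed

lemma quad_field_eq:
  "quad_field a = {x + y * csqrt (of_int a) | x y. x \<in> \<rat> \<and> y \<in> \<rat>}"
proof -
  define r where "r = csqrt (of_int a)"
  define G where "G = generate_field ring_of_type_algebra {r}"
  define T where "T = {x + y * r | x y. x \<in> \<rat> \<and> y \<in> \<rat>}"
  have r2: "r * r = of_int a"
    unfolding r_def by (metis power2_csqrt power2_eq_square)
  have one: "1 \<in> G" and rG: "r \<in> G"
    using generate_field.one[of ring_of_type_algebra "{r}"] generate_field.incl[of r "{r}"]
    by (auto simp: G_def ring_of_type_algebra_def)
  have neg: "- x \<in> G" if "x \<in> G" for x
    using generate_field.a_inv[of x ring_of_type_algebra "{r}"] that
    by (simp add: G_def uminus_complex_ring)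
  have inv: "inverse x \<in> G" if "x \<in> G" "x \<noteq> 0" for x
    using generate_field.m_inv[of x ring_of_type_algebra "{r}"] that
    by (simp add: G_def inv_complex_ring) (simp add: ring_of_type_algebra_def)
  have add: "x + y \<in> G" if "x \<in> G" "y \<in> G" for x y
    using generate_field.eng_add[of x ring_of_type_algebra "{r}" y] that
    by (simp add: G_def) (simp add: ring_of_type_algebra_def)
  have mult: "x * y \<in> G" if "x \<in> G" "y \<in> G" for x y
    using generate_field.eng_mult[of x ring_of_type_algebra "{r}" y] that
    by (simp add: G_def) (simp add: ring_of_type_algebra_def)
  have zero: "0 \<in> G"
    using add[OF one neg[OF one]] by simp
  have nat: "of_nat n \<in> G" for n
    by (induction n) (auto intro: zero add one)
  have int: "of_int k \<in> G" for k
    by (cases k rule: int_cases2) (auto intro: nat neg)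
  have rat: "q \<in> G" if "q \<in> \<rat>" for q
    using that
  proof (cases q rule: Rats_cases')
    case (1 k n)
    then have "q = of_int k * inverse (of_int n)" "of_int n \<noteq> (0 :: complex)"
      by (auto simp: divide_inverse)
    then show ?thesis
      using mult inv int by simp
  qed
  have "T \<subseteq> G"
    using rat rG add mult by (auto simp: T_def)
  moreover have "G \<subseteq> T"
  proof
    fix z assume "z \<in> G"
    then show "z \<in> T"
      unfolding G_def
    proof induction
      case one
      have "1 = 1 + 0 * r"
        by simp
      then have "1 \<in> T"
        unfolding T_def using Rats_0 Rats_1 by blast
      then show ?case
        by (simp add: ring_of_type_algebra_def)
    next
      case (incl h)
      have "r = 0 + 1 * r"
        by simp
      then have "r \<in> T"
        unfolding T_def using Rats_0 Rats_1 by blast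
      then show ?case
        using incl by simp
    next
      case (a_inv h)
      then obtain x y where "h = x + y * r" "x \<in> \<rat>" "y \<in> \<rat>"
        by (auto simp: T_def)
      then have "- h = - x + (- y) * r" "- x \<in> \<rat>" "- y \<in> \<rat>"
        by auto
      then show ?case
        unfolding T_def uminus_complex_ring by blast
    next
      case (m_inv h)
      then obtain x y where h: "h = x + y * r" "x \<in> \<rat>" "y \<in> \<rat>"
        by (auto simp: T_def)
      have h0: "h \<noteq> 0"
        using m_inv by (simp add: ring_of_type_algebra_def)
      show ?case
      proof (cases "x - y * r = 0")
        case True
        then have "h = 2 * x + 0 * r"
          using h by (simp add: algebra_simps)
        then have "inverse h = inverse (2 * x) + 0 * r" "inverse (2 * x) \<in> \<rat>"
          using h by auto
        then show ?thesis
          unfolding T_def inv_complex_ring[OF h0] using Rats_0 by blast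
      next
        case False
        define d where "d = x * x - y * y * of_int a"
        have d: "d = h * (x - y * r)"
          unfolding h d_def r2[symmetric] by (simp add: algebra_simps)
        have "d \<in> \<rat>"
          using h by (simp add: d_def)
        have "inverse h = (x - y * r) / d"
          using h0 False unfolding d by (simp add: divide_inverse)
        also have "\<dots> = x / d + (- y / d) * r"
          by (simp add: diff_divide_distrib)
        finally have "inverse h = x / d + (- y / d) * r" "x / d \<in> \<rat>" "- y / d \<in> \<rat>"
          using h \<open>d \<in> \<rat>\<close> by auto
        then show ?thesis
          unfolding T_def inv_complex_ring[OF h0] by blast
      qed
    next
      case (eng_add h k)
      then obtain x y x' y' where
        "h = x + y * r" "x \<in> \<rat>" "y \<in> \<rat>" "k = x' + y' * r" "x' \<in> \<rat>" "y' \<in> \<rat>"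
        by (auto simp: T_def)
      then have "h + k = (x + x') + (y + y') * r" "x + x' \<in> \<rat>" "y + y' \<in> \<rat>"
        by (auto simp: algebra_simps)
      then have "h + k \<in> T"
        unfolding T_def by blast
      then show ?case
        by (simp add: ring_of_type_algebra_def)
    next
      case (eng_mult h k)
      then obtain x y x' y' where hk:
        "h = x + y * r" "x \<in> \<rat>" "y \<in> \<rat>" "k = x' + y' * r" "x' \<in> \<rat>" "y' \<in> \<rat>"
        by (auto simp: T_def)
      have "h * k = (x * x' + y * y' * of_int a) + (x * y' + y * x') * r"
        unfolding hk r2[symmetric] by (simp add: algebra_simps)
      moreover have "x * x' + y * y' * of_int a \<in> \<rat>" "x * y' + y * x' \<in> \<rat>"
        using hk by auto
      ultimately have "h * k \<in> T"
        unfolding T_def by blast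
      then show ?case
        by (simp add: ring_of_type_algebra_def)
    qed
  qed
  ultimately show ?thesis
    by (auto simp: quad_field_def G_def T_def r_def)
qed

end

theory Submission
  imports Defs "HOL-Real_Asymp.Real_Asymp"
begin

text \<open>
  For each fixed \<open>s\<close>, only \<open>O(log N)\<close> integers \<open>n\<close> in an interval of length \<open>N\<close> can satisfy
  \<open>\<rat>(\<surd>u(n)) = \<rat>(\<surd>s)\<close>, uniformly in \<open>s\<close>; summing over \<open>s \<le> S\<close> gives \<open>S N ^ o(1)\<close>.

  Let \<open>x\<^sub>i = g ^ i\<close> run over such points, say with \<open>n \<le> i \<le> c n\<close> for a constant \<open>c > 1\<close> close
  to \<open>1\<close>. Any two values \<open>f(x\<^sub>i)\<close>, \<open>f(x\<^sub>j)\<close> multiply to a square, so fixing one value \<open>E\<close>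
  among them, \<open>E f(x\<^sub>i) = t\<^sub>i\<^sup>2\<close> with integers \<open>t\<^sub>i\<close>. Suppose \<open>f(0) \<noteq> 0\<close> and let \<open>D = deg f\<close>.
  Since \<open>x\<^sub>i\<close> is \<open>g\<close>-adically small, after fixing the residue of \<open>t\<^sub>i\<close> to a constant modulus, \<open>t\<^sub>i\<close> is a
  constant multiple of \<open>G(x\<^sub>i)\<close> modulo nearly \<open>g ^ (n(D + 1))\<close>, where \<open>G\<close> is the Taylor polynomial of
  degree \<open>D\<close> of \<open>\<surd>f\<close> at \<open>0\<close>. The divided difference of \<open>G\<close> at \<open>D + 2\<close> points vanishes; so the
  divided difference of the \<open>t\<^sub>i\<close>, cleared of denominators, is divisible by a power of \<open>g\<close>
  exceeding its size, and vanishes too. Hence \<open>t\<^sub>i = P(x\<^sub>i)\<close> for one polynomial \<open>P\<close> of degree at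
  most \<open>D\<close>, and with more than \<open>2 D\<close> points \<open>P\<^sup>2 = E f\<close>, contradicting the squarefreeness of \<open>f\<close>.
\<close>

section \<open>Integral Taylor polynomials of a square root\<close>

text \<open>\<open>G\<close> divided by \<open>L\<close> is the Taylor polynomial of degree
  \<open>k\<close> at 0 of the square root of \<open>f / poly f 0\<close>; \<open>L\<close> clears
  the denominators. The coefficients are found one at a time, as in Hensel lifting.\<close>

lemma truncated_sqrt:
  fixes f :: "int poly"
  assumes "poly f 0 \<noteq> 0"
  shows "\<exists>G R L. L \<noteq> 0 \<and> Polynomial.degree G \<le> k \<and> poly G 0 = L \<and>
    Polynomial.smult (poly f 0) (G ^ 2) = Polynomial.smult (L ^ 2) f + [:0, 1:] ^ Suc k * R"
proof (induction k)
  case 0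
  have "poly (1 - f + [:poly f 0 - 1:]) 0 = 0"
    by simp
  then have "[:0, 1:] dvd 1 - f + [:poly f 0 - 1:]"
    by (metis minus_zero poly_eq_0_iff_dvd)
  then obtain R where "1 - f + [:poly f 0 - 1:] = [:0, 1:] * R"
    by (elim dvdE)
  moreover have "Polynomial.smult (poly f 0) (1 ^ 2) = f + (1 - f + [:poly f 0 - 1:])"
    by (simp add: one_pCons power2_eq_square)
  ultimately have "Polynomial.smult (poly f 0) (1 ^ 2)
      = Polynomial.smult (1 ^ 2) f + [:0, 1:] ^ Suc 0 * R"
    by simp
  then show ?case
    by (intro exI[of _ 1] exI[of _ R]) simp
next
  case (Suc k)
  define c where "c = poly f 0"
  define x where "x = ([:0, 1:] :: int poly)"
  from Suc obtain G R L where
    G: "L \<noteq> 0" "Polynomial.degree G \<le> k" "poly G 0 = L"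
       "Polynomial.smult c (G ^ 2) = Polynomial.smult (L ^ 2) f + x ^ Suc k * R"
    unfolding c_def x_def by blast
  \<comment> \<open>\<open>e\<close> and \<open>h\<close> are chosen to cancel the constant term of \<open>R0\<close>.\<close>
  define e where "e = 2 * c * L"
  define h where "h = - poly R 0"
  define G' where "G' = Polynomial.smult e G + Polynomial.smult h (x ^ Suc k)"
  define R0 where "R0 = Polynomial.smult (e ^ 2) R + Polynomial.smult (2 * e * h * c) G
    + Polynomial.smult (c * h ^ 2) (x ^ Suc k)"
  have "poly R0 0 = 0"
    by (simp add: R0_def G x_def e_def h_def power2_eq_square algebra_simps)
  then have "x dvd R0"
    unfolding x_def by (metis minus_zero poly_eq_0_iff_dvd)
  then obtain R' where R': "R0 = x * R'"
    by (elim dvdE)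
  have "Polynomial.smult c (G' ^ 2) = Polynomial.smult (e ^ 2) (Polynomial.smult c (G ^ 2))
      + x ^ Suc k * (Polynomial.smult (2 * e * h * c) G + Polynomial.smult (c * h ^ 2) (x ^ Suc k))"
    by (simp add: G'_def power2_eq_square algebra_simps smult_add_right numeral_poly)
  also have "\<dots> = Polynomial.smult ((e * L) ^ 2) f + x ^ Suc k * R0"
    by (simp add: G R0_def algebra_simps smult_add_right power_mult_distrib)
  finally have "Polynomial.smult c (G' ^ 2) = Polynomial.smult ((e * L) ^ 2) f + x ^ Suc (Suc k) * R'"
    by (simp add: R' algebra_simps)
  moreover have "Polynomial.degree (x ^ Suc k) = Suc k"
    by (simp only: x_def degree_linear_power)
  then have "Polynomial.degree G' \<le> Suc k"
    unfolding G'_def using G(2) by (intro degree_add_le) (auto intro: order.trans[OF degree_smult_le])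
  moreover have "poly G' 0 = e * L"
    by (simp add: G'_def x_def G)
  moreover have "e * L \<noteq> 0"
    using assms G by (simp add: e_def c_def)
  ultimately show ?case
    unfolding c_def x_def by blast
qed

section \<open>Interpolation and divided differences\<close>

definition divided_difference :: "'i set \<Rightarrow> ('i \<Rightarrow> 'a :: field) \<Rightarrow> ('i \<Rightarrow> 'a) \<Rightarrow> 'a" where
  "divided_difference I x t = (\<Sum>i\<in>I. t i / (\<Prod>j\<in>I - {i}. x i - x j))"

text \<open>Lagrange interpolation: each basis product \<open>B i\<close> is monic of degree
  \<open>card I - 1\<close>, so the top coefficient is the sum of the weights
  \<open>w i\<close>.\<close>

lemma interpolation_exists:
  fixes x t :: "'i \<Rightarrow> 'a :: field"
  assumes "finite I" "inj_on x I"
  shows "\<exists>P. (\<forall>i\<in>I. poly P (x i) = t i) \<and> Polynomial.degree P \<le> card I - 1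
    \<and> Polynomial.coeff P (card I - 1) = divided_difference I x t"
proof -
  define B where "B = (\<lambda>i. \<Prod>j\<in>I - {i}. [:- x j, 1:])"
  define w where "w = (\<lambda>i. t i / (\<Prod>j\<in>I - {i}. x i - x j))"
  define P where "P = (\<Sum>i\<in>I. Polynomial.smult (w i) (B i))"
  have B: "Polynomial.degree (B i) = card I - 1" "Polynomial.coeff (B i) (card I - 1) = 1"
    if "i \<in> I" for i
  proof -
    show deg: "Polynomial.degree (B i) = card I - 1"
      using assms that unfolding B_def by (subst degree_prod_eq_sum_degree) auto
    have "Polynomial.lead_coeff (B i) = 1"
      unfolding B_def by (simp add: lead_coeff_prod)
    then show "Polynomial.coeff (B i) (card I - 1) = 1"
      by (simp add: deg)
  qed
  have "poly P (x i) = t i" if "i \<in> I" for i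
  proof -
    have "poly (B k) (x i) = 0" if "k \<in> I - {i}" for k
      using assms that \<open>i \<in> I\<close> by (auto simp: B_def poly_prod)
    then have "poly P (x i) = w i * poly (B i) (x i)"
      using assms that by (simp add: P_def poly_sum sum.remove[of _ i])
    moreover have "poly (B i) (x i) = (\<Prod>j\<in>I - {i}. x i - x j)"
      by (simp add: B_def poly_prod)
    moreover have "(\<Prod>j\<in>I - {i}. x i - x j) \<noteq> 0"
      using assms that by (auto simp: inj_on_def)
    ultimately show ?thesis
      by (simp add: w_def)
  qed
  moreover have "Polynomial.degree P \<le> card I - 1"
    unfolding P_def using assms B
    by (intro degree_sum_le) (auto intro: order.trans[OF degree_smult_le])
  moreover have "Polynomial.coeff P (card I - 1) = divided_difference I x t"
    unfolding P_def using B by (simp add: coeff_sum w_def divided_difference_def)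
  ultimately show ?thesis
    by blast
qed

lemma poly_eq_of_agree:
  fixes P Q :: "'a :: idom poly"
  assumes "finite I" "inj_on x I" "\<And>i. i \<in> I \<Longrightarrow> poly P (x i) = poly Q (x i)"
    and "Polynomial.degree P < card I" "Polynomial.degree Q < card I"
  shows "P = Q"
  using assms by (intro poly_eqI_degree[of "x ` I"]) (auto simp: card_image)

text \<open>Interpolating the values of \<open>P\<close> at this many points returns
  \<open>P\<close> itself, whose coefficient at \<open>card I - 1\<close> is zero.\<close>

lemma divided_difference_poly:
  fixes P :: "'a :: field poly"
  assumes "finite I" "inj_on x I" "Suc (Polynomial.degree P) < card I"
  shows "divided_difference I x (\<lambda>i. poly P (x i)) = 0"
proof -
  obtain Q where Q: "\<And>i. i \<in> I \<Longrightarrow> poly Q (x i) = poly P (x i)" "Polynomial.degree Q \<le> card I - 1"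
    "Polynomial.coeff Q (card I - 1) = divided_difference I x (\<lambda>i. poly P (x i))"
    using interpolation_exists[OF assms(1,2), of "\<lambda>i. poly P (x i)"] by blast
  have "Q = P"
    using assms Q by (intro poly_eq_of_agree[of I x]) auto
  with Q(3) assms(3) show ?thesis
    by (metis coeff_eq_0 less_diff_conv plus_1_eq_Suc add.commute)
qed

text \<open>Let \<open>P\<close> interpolate at \<open>D + 1\<close> of the points. With any further
  point added, the interpolant has a divided difference as its coefficient at \<open>D + 1\<close>,
  hence zero; so its degree is at most \<open>D\<close> and it equals \<open>P\<close>.\<close>

lemma poly_of_divided_differences_zero:
  fixes x t :: "'i \<Rightarrow> 'a :: field"
  assumes "finite A" "inj_on x A" "card A > D"
    and "\<And>I. I \<subseteq> A \<Longrightarrow> card I = D + 2 \<Longrightarrow> divided_difference I x t = 0"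
  shows "\<exists>P. Polynomial.degree P \<le> D \<and> (\<forall>i\<in>A. poly P (x i) = t i)"
proof -
  obtain J where J: "J \<subseteq> A" "card J = D + 1"
    using assms(3) obtain_subset_with_card_n[of "D + 1" A] by auto
  have fin: "finite J" and inj: "inj_on x J"
    using J assms by (auto intro: finite_subset inj_on_subset)
  obtain P where P: "\<And>i. i \<in> J \<Longrightarrow> poly P (x i) = t i" "Polynomial.degree P \<le> D"
    using interpolation_exists[OF fin inj, of t] J by auto
  have "poly P (x i) = t i" if i: "i \<in> A - J" for i
  proof -
    define I where "I = insert i J"
    have I: "I \<subseteq> A" "card I = D + 2" "finite I" "inj_on x I"
      using i J fin inj_on_subset[OF assms(2), of "insert i J"] by (auto simp: I_def)
    obtain Q where Q: "\<And>i. i \<in> I \<Longrightarrow> poly Q (x i) = t i" "Polynomial.degree Q \<le> D + 1"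
      "Polynomial.coeff Q (D + 1) = divided_difference I x t"
      using interpolation_exists[OF I(3,4), of t] I by auto
    have "Polynomial.coeff Q (D + 1) = 0"
      using Q(3) assms(4) I by simp
    with Q(2) have "Polynomial.degree Q < D + 1"
      by (metis degree_0 leading_coeff_0_iff le_neq_implies_less less_add_one add_is_0 
          le_add2 linorder_not_less less_one zero_neq_one)
    then have "Q = P"
      using Q P J fin inj by (intro poly_eq_of_agree[of J x]) (auto simp: I_def)
    then show ?thesis
      using Q(1) by (simp add: I_def)
  qed
  with P show ?thesis
    by blast
qed

text \<open>The weights of the divided difference, multiplied by all differences \<open>x k - x j\<close>.\<close>
definition cofactor :: "'i set \<Rightarrow> ('i \<Rightarrow> 'a :: comm_ring_1) \<Rightarrow> 'i \<Rightarrow> 'a" where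
  "cofactor I x i = (\<Prod>k\<in>I - {i}. \<Prod>j\<in>I - {k}. x k - x j)"

text \<open>Divisibility and size arguments need an integer, interpolation needs a field. The two
  are linked by a factor that is nonzero because the points are distinct.\<close>

lemma sum_cofactor:
  fixes x t :: "'i \<Rightarrow> int"
  assumes "finite I" "inj_on x I"
  shows "(of_int (\<Sum>i\<in>I. t i * cofactor I x i) :: complex)
    = of_int (\<Prod>k\<in>I. \<Prod>j\<in>I - {k}. x k - x j)
      * divided_difference I (\<lambda>i. of_int (x i)) (\<lambda>i. of_int (t i))"
proof -
  have "of_int (t i * cofactor I x i) = of_int (\<Prod>k\<in>I. \<Prod>j\<in>I - {k}. x k - x j)
      * (of_int (t i) / (\<Prod>j\<in>I - {i}. of_int (x i) - of_int (x j)) :: complex)"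
    if "i \<in> I" for i
  proof -
    have "(\<Prod>k\<in>I. \<Prod>j\<in>I - {k}. x k - x j) = (\<Prod>j\<in>I - {i}. x i - x j) * cofactor I x i"
      unfolding cofactor_def using assms that by (simp add: prod.remove)
    moreover have "(\<Prod>j\<in>I - {i}. complex_of_int (x i) - of_int (x j)) \<noteq> 0"
      using assms that by (auto simp: inj_on_def)
    ultimately show ?thesis
      by (simp add: field_simps)
  qed
  then show ?thesis
    by (simp add: divided_difference_def sum_distrib_left of_int_sum)
qed

lemma poly_map_of_int:
  "poly (map_poly of_int p) (of_int x) = (of_int (poly p x) :: 'a :: comm_ring_1)"
  by (induction p) (simp_all add: map_poly_pCons)

lemma sum_cofactor_poly:
  fixes x :: "'i \<Rightarrow> int" and P :: "int poly"
  assumes "finite I" "inj_on x I" "Suc (Polynomial.degree P) < card I"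
  shows "(\<Sum>i\<in>I. poly P (x i) * cofactor I x i) = 0"
proof -
  have "Suc (Polynomial.degree (map_poly of_int P :: complex poly)) < card I"
    using assms(3) by (simp add: degree_map_poly)
  moreover have "inj_on (\<lambda>i. complex_of_int (x i)) I"
    using assms(2) by (auto simp: inj_on_def)
  ultimately have "divided_difference I (\<lambda>i. complex_of_int (x i)) 
      (\<lambda>i. poly (map_poly of_int P) (complex_of_int (x i))) = 0"
    using assms by (intro divided_difference_poly)
  then have "(of_int (\<Sum>i\<in>I. poly P (x i) * cofactor I x i) :: complex) = 0"
    unfolding sum_cofactor[OF assms(1,2)] by (simp only: poly_map_of_int mult_zero_right)
  then show ?thesis
    unfolding of_int_eq_0_iff .
qed

section \<open>Congruences modulo powers of \<open>g\<close> for the square roots\<close>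

text \<open>As \<open>g\<close> need not be prime, a valuation is replaced by splitting off
  \<open>gcd L g\<close> repeatedly. This ends because \<open>\<bar>L\<bar>\<close> drops each time,
  and the number of rounds serves as \<open>k\<close>.\<close>

lemma coprime_part:
  fixes g L :: int
  assumes "L \<noteq> 0"
  shows "\<exists>e L' k. L = e * L' \<and> coprime L' g \<and> e dvd g ^ k"
  using assms
proof (induction "nat \<bar>L\<bar>" arbitrary: L rule: less_induct)
  case less
  show ?case
  proof (cases "coprime L g")
    case True
    then show ?thesis
      by (intro exI[of _ 1] exI[of _ L]) auto
  next
    case False
    define d where "d = gcd L g"
    obtain M where M: "L = d * M"
      unfolding d_def by (metis gcd_dvd1 dvdE)
    have "d > 1"
      using False less.prems unfolding d_def coprime_iff_gcd_eq_1
      by (smt (verit) gcd_pos_int)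
    then have "\<bar>M\<bar> < \<bar>L\<bar>"
      using less.prems M by (simp add: abs_mult)
    then have "nat \<bar>M\<bar> < nat \<bar>L\<bar>" "M \<noteq> 0"
      using less.prems M by auto
    then obtain e L' k where e: "M = e * L'" "coprime L' g" "e dvd g ^ k"
      using less.hyps by blast
    have "d * e dvd g ^ Suc k"
      using e d_def by (simp add: mult_dvd_mono)
    then show ?thesis
      using e M by (metis mult.assoc)
  qed
qed

text \<open>The primes of \<open>L\<close> that divide \<open>g\<close> contribute boundedly, and for large \<open>n\<close> the term
  \<open>g ^ n * q\<close> does not change their multiplicities.\<close>
lemma cancel_near_constant:
  fixes g L :: int
  assumes "L \<noteq> 0"
  shows "\<exists>k. \<forall>n\<ge>k. \<forall>m a u q. coprime u g \<longrightarrow> g ^ m dvd a * (L * u + g ^ n * q) \<longrightarrow> g ^ m dvd a * L"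
proof -
  obtain e L' k where e: "L = e * L'" "coprime L' g" "e dvd g ^ k"
    using coprime_part[OF assms] by blast
  have "g ^ m dvd a * L" if n: "n \<ge> Suc k" and "coprime u g" "g ^ m dvd a * (L * u + g ^ n * q)"
    for n m a u q
  proof -
    obtain h where h: "g ^ k = e * h"
      using e(3) by (elim dvdE)
    \<comment> \<open>As \<open>n\<close> exceeds \<open>k\<close>, a factor \<open>g\<close> is
      left over once \<open>e\<close> is taken out, so the second factor stays coprime to
      \<open>g\<close>.\<close>
    have "g ^ n = g ^ k * (g * g ^ (n - Suc k))"
      using n by (metis add_Suc_shift le_add_diff_inverse power_Suc power_add)
    then have *: "L * u + g ^ n * q = e * (L' * u + g * (h * g ^ (n - Suc k) * q))"
      by (simp add: e h algebra_simps)
    have "coprime (L' * u) g"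
      using e that by simp
    then have "coprime (L' * u + g * (h * g ^ (n - Suc k) * q)) g"
      by (metis coprime_iff_gcd_eq_1 gcd.commute gcd_add_mult mult.commute add.commute)
    then have "coprime (g ^ m) (L' * u + g * (h * g ^ (n - Suc k) * q))"
      by (simp add: coprime_commute)
    moreover have "g ^ m dvd (a * e) * (L' * u + g * (h * g ^ (n - Suc k) * q))"
      using that(3) unfolding * by (simp add: mult.assoc)
    ultimately have "g ^ m dvd a * e"
      using coprime_dvd_mult_left_iff by blast
    then show ?thesis
      unfolding e by (simp add: mult.assoc[symmetric])
  qed
  then show ?thesis
    by blast
qed

lemma dvd_poly_diff_const: 
  fixes p :: "int poly"
  assumes "m dvd x"
  shows "m dvd poly p x - poly p 0"
  using assms by (cases p) auto

text \<open>Modulo the power \<open>D + 1\<close> of the variable, \<open>f\<close> is a constant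
  multiple of \<open>G ^ 2\<close>; so, up to a constant factor, the squares of
  \<open>t * poly G y\<close> and \<open>u * poly G x\<close> agree modulo
  \<open>g ^ (n * (D + 1))\<close>. Their difference factors. The condition
  \<open>K * g dvd t - u\<close> fixes the sign: the sum of the two is kept away from high powers of
  \<open>g\<close>, so the difference takes the whole power.\<close>

lemma root_congruence:
  fixes g :: int and f :: "int poly"
  assumes f0: "poly f 0 \<noteq> 0"
  shows "\<exists>G C K k. Polynomial.degree G \<le> D \<and> poly G 0 \<noteq> 0 \<and> C \<noteq> 0 \<and> K \<noteq> 0 \<and>
    (\<forall>n\<ge>k. \<forall>E x y t u. g ^ n dvd x \<longrightarrow> g ^ n dvd y \<longrightarrow> g ^ n dvd E - poly f 0 \<longrightarrow>
      t ^ 2 = E * poly f x \<longrightarrow> u ^ 2 = E * poly f y \<longrightarrow> K * g dvd t - u \<longrightarrow>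
      g ^ (n * (D + 1)) dvd (t * poly G y - u * poly G x) * C)"
proof -
  define c where "c = poly f 0"
  obtain G R L where G: "L \<noteq> 0" "Polynomial.degree G \<le> D" "poly G 0 = L"
    "Polynomial.smult c (G ^ 2) = Polynomial.smult (L ^ 2) f + [:0, 1:] ^ Suc D * R"
    unfolding c_def using truncated_sqrt[OF f0] by blast
  \<comment> \<open>\<open>K\<close> approximates \<open>b ^ 2\<close> below, since
    \<open>u ^ 2\<close> is close to \<open>c ^ 2\<close> and the values of \<open>G\<close> are
    close to \<open>L\<close>; \<open>C\<close> is \<open>L ^ 2 * K\<close>.\<close>
  define K where "K = 4 * c ^ 2 * L ^ 2"
  define C where "C = 4 * c ^ 2 * L ^ 4"
  have nz: "C \<noteq> 0" "K \<noteq> 0"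
    using f0 G by (auto simp: C_def K_def c_def)
  obtain k where k: "\<And>n m a u q. n \<ge> k \<Longrightarrow> coprime u g \<Longrightarrow>
      g ^ m dvd a * (C * u + g ^ n * q) \<Longrightarrow> g ^ m dvd a * C"
    using cancel_near_constant[OF nz(1), of g] by blast
  have "g ^ (n * (D + 1)) dvd (t * poly G y - u * poly G x) * C"
    if n: "n \<ge> k" and x: "g ^ n dvd x" and y: "g ^ n dvd y" and E: "g ^ n dvd E - c"
      and t: "t ^ 2 = E * poly f x" and u: "u ^ 2 = E * poly f y" and tu: "K * g dvd t - u"
    for n E x y t u
  proof -
    \<comment> \<open>\<open>L\<^sup>2 a b\<close> has the required divisibility, while \<open>L\<^sup>2 b\<^sup>2\<close> is \<open>g\<close>-adically \<open>C\<close> times a unit, so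
      the factor \<open>b\<close> can be dropped.\<close>
    define a b where "a = t * poly G y - u * poly G x" and "b = t * poly G y + u * poly G x"
    define M where "M = g ^ (n * (D + 1))"
    have f: "L ^ 2 * poly f z = c * poly G z ^ 2 - z ^ Suc D * poly R z" for z
      using arg_cong[OF G(4), of "\<lambda>p. poly p z"] by (simp add: algebra_simps)
    have "L ^ 2 * (a * b) = L ^ 2 * (t ^ 2 * poly G y ^ 2 - u ^ 2 * poly G x ^ 2)"
      by (simp add: a_def b_def power2_eq_square algebra_simps)
    also have "\<dots> = E * ((L ^ 2 * poly f x) * poly G y ^ 2 - (L ^ 2 * poly f y) * poly G x ^ 2)"
      by (simp add: t u algebra_simps)
    also have "\<dots> = y ^ Suc D * (E * poly R y * poly G x ^ 2) - x ^ Suc D * (E * poly R x * poly G y ^ 2)"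
      unfolding f by (simp add: algebra_simps)
    finally have Lab: "L ^ 2 * (a * b) = \<dots>" .
    have pow: "M dvd z ^ Suc D" if "g ^ n dvd z" for z
      using dvd_power_same[OF that, of "Suc D"] by (simp only: M_def power_mult Suc_eq_plus1)
    have "M dvd L ^ 2 * (a * b)"
      unfolding Lab using pow[OF x] pow[OF y] by (intro dvd_diff dvd_mult2)
    \<comment> \<open>One more \<open>b\<close> is multiplied in because only \<open>u ^ 2\<close>,
      not \<open>u\<close> itself, has been evaluated modulo \<open>g ^ n\<close>; this suffices to
      approximate \<open>b ^ 2\<close>.\<close>
    then have Mdvd: "M dvd a * (L ^ 2 * b ^ 2)"
      using dvd_mult2[of M "L ^ 2 * (a * b)" b] by (simp add: power2_eq_square ac_simps)
    have Gx: "g ^ n dvd poly G x - L" and Gy: "g ^ n dvd poly G y - L" and fy: "g ^ n dvd poly f y - c"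
      using dvd_poly_diff_const[OF x, of G] dvd_poly_diff_const[OF y, of G] dvd_poly_diff_const[OF y, of f]
      by (auto simp: G(3) c_def)
    obtain h where h: "t - u = K * g * h"
      using tu by (elim dvdE)
    obtain q1 where q1: "poly G x = L + g ^ n * q1"
      using Gx by (metis diff_eq_eq dvdE add.commute)
    obtain q2 where q2: "poly G y = L + g ^ n * q2"
      using Gy by (metis diff_eq_eq dvdE add.commute)
    obtain q3 where q3: "poly f y = c + g ^ n * q3"
      using fy by (metis diff_eq_eq dvdE add.commute)
    obtain q4 where q4: "E = c + g ^ n * q4"
      using E by (metis diff_eq_eq dvdE add.commute)
    have "u ^ 2 = c ^ 2 + g ^ n * (c * q3 + c * q4 + g ^ n * q3 * q4)"
      unfolding u q3 q4 by (simp add: power2_eq_square algebra_simps)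
    then obtain q5 where q5: "u ^ 2 = c ^ 2 + g ^ n * q5"
      by blast
    have "u ^ 2 * poly G x ^ 2 = c ^ 2 * L ^ 2 + g ^ n * (q5 * poly G x ^ 2 + c ^ 2 * (2 * L * q1 + g ^ n * q1 ^ 2))"
      unfolding q5 q1 by (simp add: power2_eq_square algebra_simps)
    then obtain q6 where q6: "u ^ 2 * poly G x ^ 2 = c ^ 2 * L ^ 2 + g ^ n * q6"
      by blast
    \<comment> \<open>As \<open>b = a + 2 * u * poly G x\<close>, the square \<open>b ^ 2\<close>
      differs from \<open>4 * (u ^ 2 * poly G x ^ 2)\<close> by \<open>a * w\<close>, and
      \<open>a\<close> is a multiple of \<open>K * g\<close> up to a multiple of
      \<open>g ^ n\<close>.\<close>
    define w where "w = 4 * u * poly G x + a"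
    have a: "a = K * g * h * poly G y + g ^ n * (u * (q2 - q1))"
      unfolding a_def h[symmetric] q1 q2 by (simp add: algebra_simps)
    have "b ^ 2 = 4 * (u ^ 2 * poly G x ^ 2) + a * w"
      by (simp add: a_def b_def w_def power2_eq_square algebra_simps)
    also have "\<dots> = K * (1 + g * (h * poly G y * w)) + g ^ n * (4 * q6 + u * (q2 - q1) * w)"
      unfolding q6 by (subst a) (simp add: K_def algebra_simps)
    finally have b2: "b ^ 2 = \<dots>" .
    have "C = L ^ 2 * K"
      by (simp add: K_def C_def power2_eq_square power4_eq_xxxx)
    then have "L ^ 2 * b ^ 2 = C * (1 + g * (h * poly G y * w)) + g ^ n * (L ^ 2 * (4 * q6 + u * (q2 - q1) * w))"
      unfolding b2 by (simp add: algebra_simps)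
    with Mdvd have "M dvd a * (C * (1 + g * (h * poly G y * w)) + g ^ n * (L ^ 2 * (4 * q6 + u * (q2 - q1) * w)))"
      by simp
    moreover have "coprime (1 + g * (h * poly G y * w)) g"
      by (metis coprime_1_left coprime_iff_gcd_eq_1 gcd.commute gcd_add_mult mult.commute add.commute)
    ultimately show ?thesis
      using k[OF n] unfolding M_def a_def by blast
  qed
  then show ?thesis
    using G(1-3) nz unfolding c_def
    by (intro exI[of _ G] exI[of _ C] exI[of _ K] exI[of _ k]) simp
qed

text \<open>The exponent counts the differences in a cofactor: \<open>D + 1\<close> choices of
  \<open>k\<close>, each with \<open>D + 1\<close> choices of \<open>j\<close>.\<close>

lemma cofactor_dvd:
  fixes x :: "'i \<Rightarrow> int"
  assumes "finite I" "card I = D + 2" "\<And>i. i \<in> I \<Longrightarrow> m dvd x i" "i \<in> I"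
  shows "m ^ (D + 1) ^ 2 dvd cofactor I x i"
proof -
  have "m ^ (D + 1) dvd (\<Prod>j\<in>I - {k}. x k - x j)" if "k \<in> I" for k
  proof -
    have "(\<Prod>j\<in>I - {k}. m) dvd (\<Prod>j\<in>I - {k}. x k - x j)"
      using assms that by (intro prod_dvd_prod) auto
    then show ?thesis
      using assms that by simp
  qed
  then have "(\<Prod>k\<in>I - {i}. m ^ (D + 1)) dvd cofactor I x i"
    unfolding cofactor_def using assms by (intro prod_dvd_prod) auto
  moreover have card: "card (I - {i}) = D + 1"
    using assms by simp
  have "(\<Prod>k\<in>I - {i}. m ^ (D + 1)) = m ^ (D + 1) ^ 2"
    unfolding prod_constant card power2_eq_square power_mult ..
  ultimately show ?thesis
    by simp
qed

lemma cofactor_abs_le: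
  fixes x :: "'i \<Rightarrow> int"
  assumes "finite I" "card I = D + 2" "\<And>i. i \<in> I \<Longrightarrow> 0 \<le> x i \<and> x i \<le> y" "i \<in> I"
  shows "\<bar>cofactor I x i\<bar> \<le> y ^ (D + 1) ^ 2"
proof -
  have "\<bar>\<Prod>j\<in>I - {k}. x k - x j\<bar> \<le> y ^ (D + 1)" if "k \<in> I" for k
  proof -
    have "\<bar>\<Prod>j\<in>I - {k}. x k - x j\<bar> \<le> (\<Prod>j\<in>I - {k}. y)"
      unfolding abs_prod
    proof (intro prod_mono conjI)
      fix j assume "j \<in> I - {k}"
      then show "\<bar>x k - x j\<bar> \<le> y"
        using assms(3)[of k] assms(3)[of j] that by auto
    qed auto
    then show ?thesis
      using assms that by simp
  qed
  then have "\<bar>cofactor I x i\<bar> \<le> (\<Prod>k\<in>I - {i}. y ^ (D + 1))"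
    unfolding cofactor_def abs_prod[of _ "I - {i}"] by (intro prod_mono) auto
  moreover have card: "card (I - {i}) = D + 1"
    using assms by simp
  have "(\<Prod>k\<in>I - {i}. y ^ (D + 1)) = y ^ (D + 1) ^ 2"
    unfolding prod_constant card power2_eq_square power_mult ..
  ultimately show ?thesis
    by simp
qed

text \<open>The same sum formed with the values of \<open>G\<close> is zero, so a multiple of it may
  be subtracted. After multiplication by \<open>poly G (x j)\<close> and the constant of
  \<open>root_congruence\<close>, each term then contains the difference treated there, which gives
  the exponent \<open>n * (D + 1)\<close>; the cofactor adds \<open>n * (D + 1) ^ 2\<close>. Finally
  \<open>poly G (x j)\<close> is nearly constant and is cancelled at the cost of the constant
  \<open>poly G 0\<close>.\<close>

lemma sum_cofactor_dvd:
  fixes g :: int and f :: "int poly"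
  assumes f0: "poly f 0 \<noteq> 0"
  shows "\<exists>C K k. C \<noteq> 0 \<and> K \<noteq> 0 \<and>
    (\<forall>n\<ge>k. \<forall>E x t. \<forall>I :: 'i set. card I = D + 2 \<longrightarrow> inj_on x I \<longrightarrow> g ^ n dvd E - poly f 0 \<longrightarrow>
      (\<forall>i\<in>I. g ^ n dvd x i \<and> t i ^ 2 = E * poly f (x i)) \<longrightarrow> (\<forall>i\<in>I. \<forall>j\<in>I. K * g dvd t i - t j) \<longrightarrow>
      g ^ (n * ((D + 1) * (D + 2))) dvd (\<Sum>i\<in>I. t i * cofactor I x i) * C)"
proof -
  obtain G C K k1 where G: "Polynomial.degree G \<le> D" "poly G 0 \<noteq> 0" "C \<noteq> 0" "K \<noteq> 0"
    and "\<forall>n\<ge>k1. \<forall>E x y t u. g ^ n dvd x \<longrightarrow> g ^ n dvd y \<longrightarrow> g ^ n dvd E - poly f 0 \<longrightarrow>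
      t ^ 2 = E * poly f x \<longrightarrow> u ^ 2 = E * poly f y \<longrightarrow> K * g dvd t - u \<longrightarrow>
      g ^ (n * (D + 1)) dvd (t * poly G y - u * poly G x) * C"
    using root_congruence[OF f0, of D g] by (elim exE conjE) (rule that)
  then have cong: "g ^ (n * (D + 1)) dvd (t * poly G y - u * poly G x) * C"
    if "n \<ge> k1" "g ^ n dvd x" "g ^ n dvd y" "g ^ n dvd E - poly f 0"
      "t ^ 2 = E * poly f x" "u ^ 2 = E * poly f y" "K * g dvd t - u" for n E x y t u
    using that by simp
  obtain k2 where k2: "\<And>n m a u q. n \<ge> k2 \<Longrightarrow> coprime u g \<Longrightarrow>
      g ^ m dvd a * (poly G 0 * u + g ^ n * q) \<Longrightarrow> g ^ m dvd a * poly G 0"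
    using cancel_near_constant[OF G(2), of g] by blast
  have "g ^ (n * ((D + 1) * (D + 2))) dvd (\<Sum>i\<in>I. t i * cofactor I x i) * (C * poly G 0)"
    if n: "n \<ge> max k1 k2" and I: "card I = D + 2" "inj_on x I" and E: "g ^ n dvd E - poly f 0"
      and xt: "\<And>i. i \<in> I \<Longrightarrow> g ^ n dvd x i" "\<And>i. i \<in> I \<Longrightarrow> t i ^ 2 = E * poly f (x i)"
      and K: "\<And>i j. i \<in> I \<Longrightarrow> j \<in> I \<Longrightarrow> K * g dvd t i - t j"
    for n E x t and I :: "'i set"
  proof -
    define S where "S = (\<Sum>i\<in>I. t i * cofactor I x i)"
    have fin: "finite I"
      using I by (intro card_ge_0_finite) auto
    obtain j where j: "j \<in> I"
      using I by fastforce
    have "(\<Sum>i\<in>I. poly G (x i) * cofactor I x i) = 0"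
      using G I fin by (intro sum_cofactor_poly) auto
    then have "(S * C) * poly G (x j) = (S * C) * poly G (x j)
        - t j * C * (\<Sum>i\<in>I. poly G (x i) * cofactor I x i)"
      by simp
    also have "\<dots> = (\<Sum>i\<in>I. ((t i * poly G (x j) - t j * poly G (x i)) * C) * cofactor I x i)"
      by (simp add: S_def sum_distrib_left sum_distrib_right sum_subtractf[symmetric] algebra_simps)
    finally have eq: "(S * C) * poly G (x j) = \<dots>" .
    have "g ^ (n * ((D + 1) * (D + 2))) dvd (S * C) * poly G (x j)"
      unfolding eq
    proof (rule dvd_sum)
      fix i assume i: "i \<in> I"
      have "g ^ (n * (D + 1)) dvd (t i * poly G (x j) - t j * poly G (x i)) * C"
        using n i j xt E K by (intro cong) auto
      moreover have "(g ^ n) ^ (D + 1) ^ 2 dvd cofactor I x i"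
        using fin I xt i by (intro cofactor_dvd) auto
      moreover have "n * ((D + 1) * (D + 2)) = n * (D + 1) + n * (D + 1) ^ 2"
        by (simp add: power2_eq_square algebra_simps)
      ultimately show "g ^ (n * ((D + 1) * (D + 2))) dvd
          ((t i * poly G (x j) - t j * poly G (x i)) * C) * cofactor I x i"
        by (simp only: power_add power_mult[of g n "(D + 1) ^ 2"] mult_dvd_mono)
    qed
    moreover obtain q where "poly G (x j) - poly G 0 = g ^ n * q"
      using dvd_poly_diff_const[OF xt(1)[OF j], of G] by (elim dvdE)
    then have "poly G (x j) = poly G 0 * 1 + g ^ n * q"
      by simp
    ultimately have "g ^ (n * ((D + 1) * (D + 2))) dvd (S * C) * (poly G 0 * 1 + g ^ n * q)"
      by (simp only:)
    then have "g ^ (n * ((D + 1) * (D + 2))) dvd (S * C) * poly G 0"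
      using n by (intro k2[of n 1]) auto
    then show ?thesis
      by (simp add: S_def mult.assoc)
  qed
  then show ?thesis
    using G by (intro exI[of _ "C * poly G 0"] exI[of _ K] exI[of _ "max k1 k2"]) simp
qed

section \<open>Size bounds and the conflict with squarefreeness\<close>

lemma poly_abs_le:
  fixes p :: "int poly"
  assumes "0 \<le> x" "x \<le> y" "1 \<le> y"
  shows "\<bar>poly p x\<bar> \<le> (\<Sum>i\<le>Polynomial.degree p. \<bar>Polynomial.coeff p i\<bar>) * y ^ Polynomial.degree p"
proof -
  have "\<bar>poly p x\<bar> \<le> (\<Sum>i\<le>Polynomial.degree p. \<bar>Polynomial.coeff p i * x ^ i\<bar>)"
    unfolding poly_altdef by (rule sum_abs)
  also have "\<dots> \<le> (\<Sum>i\<le>Polynomial.degree p. \<bar>Polynomial.coeff p i\<bar> * y ^ Polynomial.degree p)"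
  proof (rule sum_mono)
    fix i assume "i \<in> {..Polynomial.degree p}"
    then have "x ^ i \<le> y ^ Polynomial.degree p"
      using assms by (meson atMost_iff order.trans power_increasing power_mono)
    then show "\<bar>Polynomial.coeff p i * x ^ i\<bar> \<le> \<bar>Polynomial.coeff p i\<bar> * y ^ Polynomial.degree p"
      using assms by (simp add: abs_mult mult_left_mono)
  qed
  finally show ?thesis
    by (simp add: sum_distrib_right)
qed

lemma card_le_of_fibres:
  assumes "finite B" "\<And>a. a \<in> A \<Longrightarrow> h a \<in> B" "\<And>b. b \<in> B \<Longrightarrow> card {a \<in> A. h a = b} \<le> m"
  shows "card A \<le> card B * m"
proof (cases "finite A")
  case True
  have "A = (\<Union>b\<in>B. {a \<in> A. h a = b})"
    using assms by auto
  then have "card A \<le> (\<Sum>b\<in>B. card {a \<in> A. h a = b})"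
    using card_UN_le[OF assms(1)] by metis
  also have "\<dots> \<le> (\<Sum>b\<in>B. m)"
    by (rule sum_mono) (use assms in auto)
  finally show ?thesis
    by simp
qed auto

text \<open>A root of \<open>P\<close> would be a common root of \<open>f\<close> and its
  derivative.\<close>

lemma rsquarefree_not_square:
  fixes f :: "complex poly"
  assumes "Polynomial.rsquarefree f" "Polynomial.degree f \<ge> 1" "E \<noteq> 0"
  shows "P ^ 2 \<noteq> Polynomial.smult E f"
proof
  assume eq: "P ^ 2 = Polynomial.smult E f"
  have "Polynomial.degree P \<noteq> 0"
    using eq assms by (metis degree_power_eq degree_smult_eq mult_0_right not_one_le_zero power_eq_0_iff
        degree_0 zero_less_numeral)
  then obtain z where z: "poly P z = 0"
    by (meson fundamental_theorem_of_algebra constant_degree)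
  have "E * poly f z = 0"
    using arg_cong[OF eq, of "\<lambda>p. poly p z"] z by simp
  moreover have "E * poly (Polynomial.pderiv f) z = 0"
    using arg_cong[OF eq, of "\<lambda>p. poly (Polynomial.pderiv p) z"] z
    by (simp add: pderiv_smult power2_eq_square pderiv_mult)
  ultimately show False
    using assms unfolding rsquarefree_roots by auto
qed

lemma sum_cofactor_zero_imp:
  fixes x t :: "'i \<Rightarrow> int"
  assumes "finite I" "inj_on x I" "(\<Sum>i\<in>I. t i * cofactor I x i) = 0"
  shows "divided_difference I (\<lambda>i. complex_of_int (x i)) (\<lambda>i. complex_of_int (t i)) = 0"
proof -
  define z where "z = (\<Prod>k\<in>I. \<Prod>j\<in>I - {k}. x k - x j)"
  have "z \<noteq> 0"
    unfolding z_def using assms by (auto simp: inj_on_def)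
  moreover have "of_int z * divided_difference I (\<lambda>i. complex_of_int (x i)) (\<lambda>i. of_int (t i)) = 0"
    using sum_cofactor[OF assms(1,2), of t] unfolding assms(3) z_def[symmetric] by simp
  ultimately show ?thesis
    by simp
qed

text \<open>The values \<open>t i\<close> lie on a polynomial \<open>P\<close> of degree at most
  that of \<open>f\<close>. Then \<open>P ^ 2\<close> and \<open>E\<close> times \<open>f\<close>
  have degree at most \<open>2 * degree f\<close> and agree at all points of \<open>A\<close>; a
  larger \<open>A\<close> would make them equal.\<close>

lemma square_values_on_polynomial:
  fixes f :: "int poly" and x t :: "'i \<Rightarrow> int"
  assumes sqf: "Polynomial.rsquarefree (map_poly of_int f :: complex poly)"
    and deg: "Polynomial.degree f \<ge> 1" and "E \<noteq> 0"
    and A: "finite A" "inj_on x A" "\<And>i. i \<in> A \<Longrightarrow> t i ^ 2 = E * poly f (x i)"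
    and zero: "\<And>I. I \<subseteq> A \<Longrightarrow> card I = Polynomial.degree f + 2 \<Longrightarrow> (\<Sum>i\<in>I. t i * cofactor I x i) = 0"
  shows "card A \<le> 2 * Polynomial.degree f + 1"
proof (rule ccontr)
  assume "\<not> ?thesis"
  then have card: "card A > 2 * Polynomial.degree f"
    by simp
  define xc where "xc = (\<lambda>i. complex_of_int (x i))"
  define F where "F = (map_poly of_int f :: complex poly)"
  have inj: "inj_on xc A"
    using A(2) by (auto simp: inj_on_def xc_def)
  have "\<exists>P. Polynomial.degree P \<le> Polynomial.degree f \<and> (\<forall>i\<in>A. poly P (xc i) = of_int (t i))"
  proof (rule poly_of_divided_differences_zero[OF A(1) inj])
    fix I assume I: "I \<subseteq> A" "card I = Polynomial.degree f + 2"
    then show "divided_difference I xc (\<lambda>i. of_int (t i)) = 0"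
      unfolding xc_def using A
      by (intro sum_cofactor_zero_imp zero) (auto intro: finite_subset inj_on_subset)
  qed (use card in auto)
  then obtain P where P: "Polynomial.degree P \<le> Polynomial.degree f"
    "\<And>i. i \<in> A \<Longrightarrow> poly P (xc i) = of_int (t i)"
    by blast
  have degF: "Polynomial.degree F = Polynomial.degree f"
    unfolding F_def by (intro degree_map_poly) auto
  have "P ^ 2 = Polynomial.smult (of_int E) F"
  proof (rule poly_eq_of_agree[OF A(1) inj])
    fix i assume i: "i \<in> A"
    have "complex_of_int (t i ^ 2) = of_int (E * poly f (x i))"
      using A(3)[OF i] by simp
    then show "poly (P ^ 2) (xc i) = poly (Polynomial.smult (of_int E) F) (xc i)"
      using P(2)[OF i] by (simp add: F_def xc_def poly_map_of_int)
  next
    have "Polynomial.degree (P ^ 2) \<le> Polynomial.degree P * 2"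
      by (rule degree_power_le)
    then show "Polynomial.degree (P ^ 2) < card A"
      using P(1) card by simp
    show "Polynomial.degree (Polynomial.smult (of_int E) F) < card A"
      using card degF le_less_trans[OF degree_smult_le] by fastforce
  qed
  moreover have "P ^ 2 \<noteq> Polynomial.smult (of_int E) F"
    using sqf deg \<open>E \<noteq> 0\<close> degF unfolding F_def by (intro rsquarefree_not_square) auto
  ultimately show False
    by contradiction
qed

text \<open>The exponent is \<open>D\<close> from \<open>t i\<close> plus \<open>(D + 1) ^ 2\<close>
  from the cofactor. It is one less than the factor \<open>(D + 1) * (D + 2)\<close> in
  \<open>sum_cofactor_dvd\<close>, and this gain of one is what forces the sum to vanish.\<close>

lemma abs_sum_cofactor_le:
  fixes x t :: "'i \<Rightarrow> int"
  assumes I: "finite I" "card I = D + 2"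
    and "\<And>i. i \<in> I \<Longrightarrow> 0 \<le> x i \<and> x i \<le> y" "\<And>i. i \<in> I \<Longrightarrow> \<bar>t i\<bar> \<le> F * y ^ D"
    and "0 \<le> F" "0 \<le> y"
  shows "\<bar>\<Sum>i\<in>I. t i * cofactor I x i\<bar> \<le> int (D + 2) * F * y ^ (D + (D + 1) ^ 2)"
proof -
  have "\<bar>\<Sum>i\<in>I. t i * cofactor I x i\<bar> \<le> (\<Sum>i\<in>I. \<bar>t i * cofactor I x i\<bar>)"
    by (rule sum_abs)
  also have "\<dots> \<le> (\<Sum>i\<in>I. (F * y ^ D) * y ^ (D + 1) ^ 2)"
    unfolding abs_mult using assms cofactor_abs_le[OF I assms(3)]
    by (intro sum_mono mult_mono) auto
  also have "\<dots> = int (D + 2) * F * y ^ (D + (D + 1) ^ 2)"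
    using I by (simp only: sum_constant) (simp add: power_add algebra_simps)
  finally show ?thesis .
qed

text \<open>Let \<open>n\<close> and \<open>N\<close> be the least and greatest index. A nonzero
  cofactor sum is, up to constants, at least \<open>g ^ (n * (e + 1))\<close> and at most
  \<open>g ^ (N * e)\<close>. The window condition makes \<open>2 * N * e\<close> at most
  \<open>(2 * e + 1) * n\<close>, so \<open>g ^ n\<close> would be bounded by a constant.\<close>

lemma square_products_bounded_nonzero:
  fixes g :: int and f :: "int poly"
  assumes g: "g > 1" and f0: "poly f 0 \<noteq> 0" and deg: "Polynomial.degree f \<ge> 1"
    and sqf: "Polynomial.rsquarefree (map_poly of_int f :: complex poly)"
  shows "\<exists>B k e. e > 0 \<and> (\<forall>A. finite A \<longrightarrow> (\<forall>i\<in>A. i \<ge> k) \<longrightarrow> (\<forall>i\<in>A. \<forall>j\<in>A. 2 * e * i \<le> (2 * e + 1) * j) \<longrightarrow>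
    (\<forall>i\<in>A. \<forall>j\<in>A. \<exists>t. poly f (g ^ i) * poly f (g ^ j) = t ^ 2) \<longrightarrow> card A \<le> B)"
proof -
  define D where "D = Polynomial.degree f"
  define e where "e = D + (D + 1) ^ 2"
  define F where "F = (\<Sum>i\<le>D. \<bar>Polynomial.coeff f i\<bar>)"
  have "\<exists>C K k. C \<noteq> 0 \<and> K \<noteq> 0 \<and>
    (\<forall>n\<ge>k. \<forall>E x t. \<forall>I :: nat set. card I = D + 2 \<longrightarrow> inj_on x I \<longrightarrow> g ^ n dvd E - poly f 0 \<longrightarrow>
      (\<forall>i\<in>I. g ^ n dvd x i \<and> t i ^ 2 = E * poly f (x i)) \<longrightarrow> (\<forall>i\<in>I. \<forall>j\<in>I. K * g dvd t i - t j) \<longrightarrow>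
      g ^ (n * ((D + 1) * (D + 2))) dvd (\<Sum>i\<in>I. t i * cofactor I x i) * C)"
    by (rule sum_cofactor_dvd[OF f0])
  then obtain C K k where CK: "C \<noteq> 0" "K \<noteq> 0" and "\<forall>n\<ge>k. \<forall>E x t. \<forall>I :: nat set. card I = D + 2 \<longrightarrow>
      inj_on x I \<longrightarrow> g ^ n dvd E - poly f 0 \<longrightarrow>
      (\<forall>i\<in>I. g ^ n dvd x i \<and> t i ^ 2 = E * poly f (x i)) \<longrightarrow> (\<forall>i\<in>I. \<forall>j\<in>I. K * g dvd t i - t j) \<longrightarrow>
      g ^ (n * ((D + 1) * (D + 2))) dvd (\<Sum>i\<in>I. t i * cofactor I x i) * C"
    by (elim exE conjE) (rule that)
  then have dvdS: "g ^ (n * ((D + 1) * (D + 2))) dvd (\<Sum>i\<in>I. t i * cofactor I x i) * C"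
    if "n \<ge> k" "card I = D + 2" "inj_on x I" "g ^ n dvd E - poly f 0"
      "\<forall>i\<in>I. g ^ n dvd x i \<and> t i ^ 2 = E * poly f (x i)" "\<forall>i\<in>I. \<forall>j\<in>I. K * g dvd t i - t j"
    for n E x t and I :: "nat set"
    using that by simp
  define m where "m = \<bar>K * g\<bar>"
  define C' where "C' = \<bar>C\<bar> * int (D + 2) * F"
  \<comment> \<open>The three lower bounds serve \<open>dvdS\<close>, the final contradiction with
    \<open>g ^ n \<le> C' ^ 2\<close>, and \<open>E \<noteq> 0\<close>.\<close>
  define k' where "k' = Max {k, nat (C' ^ 2), nat \<bar>poly f 0\<bar>}"
  have m: "m > 0"
    using CK g by (simp add: m_def)
  have F: "F \<ge> 0"
    unfolding F_def by (intro sum_nonneg) auto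
  have bound: "card A \<le> nat m * (2 * D + 1)"
    if A: "finite A" and ge: "\<And>i. i \<in> A \<Longrightarrow> i \<ge> k'"
      and win: "\<And>i j. i \<in> A \<Longrightarrow> j \<in> A \<Longrightarrow> 2 * e * i \<le> (2 * e + 1) * j"
      and sq: "\<And>i j. i \<in> A \<Longrightarrow> j \<in> A \<Longrightarrow> \<exists>t. poly f (g ^ i) * poly f (g ^ j) = t ^ 2"
    for A
  proof (cases "A = {}")
    case False
    define n N where "n = Min A" and "N = Max A"
    have n: "n \<in> A" "\<And>i. i \<in> A \<Longrightarrow> n \<le> i" and N: "N \<in> A" "\<And>i. i \<in> A \<Longrightarrow> i \<le> N"
      using A False by (auto simp: n_def N_def)
    have nk: "n \<ge> k" "nat (C' ^ 2) \<le> n" "nat \<bar>poly f 0\<bar> \<le> n"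
      using ge[OF n(1)] by (auto simp: k'_def)
    define x where "x = (\<lambda>i::nat. g ^ i)"
    define E where "E = poly f (x n)"
    have inj: "inj_on x I" for I
      using g by (auto simp: inj_on_def x_def)
    have gn: "g ^ n > int n"
    proof -
      have "int n < 2 ^ n"
        by (metis of_nat_less_two_power)
      also have "2 ^ n \<le> g ^ n"
        using g by (intro power_mono) auto
      finally show ?thesis .
    qed
    have xdvd: "g ^ n dvd x i" if "i \<in> A" for i
      using n(2)[OF that] by (simp add: x_def le_imp_power_dvd)
    have Edvd: "g ^ n dvd E - poly f 0"
      unfolding E_def using xdvd[OF n(1)] by (rule dvd_poly_diff_const)
    have E: "E \<noteq> 0"
    proof
      assume "E = 0"
      then have "g ^ n dvd poly f 0"
        using Edvd by simp
      then have "g ^ n \<le> \<bar>poly f 0\<bar>"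
        using f0 by (metis abs_ge_self dvd_imp_le_int order.trans)
      then show False
        using gn nk(3) by linarith
    qed
    obtain t where t: "\<And>i. i \<in> A \<Longrightarrow> t i ^ 2 = E * poly f (x i)"
      using sq[OF n(1)] unfolding E_def x_def by metis
    have x_le: "0 \<le> x i \<and> x i \<le> g ^ N" if "i \<in> A" for i
      using g N(2)[OF that] by (simp add: x_def power_increasing)
    have "1 \<le> g ^ N"
      using g by simp
    then have fle: "\<bar>poly f (x i)\<bar> \<le> F * (g ^ N) ^ D" if "i \<in> A" for i
      using x_le[OF that] poly_abs_le[of "x i" "g ^ N" f] by (simp add: F_def D_def)
    have tle: "\<bar>t i\<bar> \<le> F * (g ^ N) ^ D" if i: "i \<in> A" for i
    proof -
      have "\<bar>t i\<bar> ^ 2 = \<bar>E\<bar> * \<bar>poly f (x i)\<bar>"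
        by (simp add: t[OF i] flip: abs_mult)
          (metis abs_of_nonneg t[OF i] zero_le_power2)
      also have "\<dots> \<le> (F * (g ^ N) ^ D) * (F * (g ^ N) ^ D)"
        using fle[OF i] fle[OF n(1)] by (intro mult_mono) (auto simp: E_def intro: order.trans[OF abs_ge_zero])
      finally have "\<bar>t i\<bar> ^ 2 \<le> (F * (g ^ N) ^ D) ^ 2"
        by (simp add: power2_eq_square)
      moreover have "0 \<le> F * (g ^ N) ^ D"
        using F g by (intro mult_nonneg_nonneg zero_le_power) auto
      ultimately show ?thesis
        by (rule power2_le_imp_le)
    qed
    have gap: "2 * e * N \<le> (2 * e + 1) * n"
      using N(1) n(1) by (rule win)
    \<comment> \<open>Within one residue class of the \<open>t i\<close> modulo \<open>m\<close>,
      all differences are divisible by \<open>K * g\<close>, as \<open>dvdS\<close> requires; there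
      are \<open>m\<close> classes.\<close>
    have "card {i \<in> A. t i mod m = b} \<le> 2 * D + 1" for b
      unfolding D_def
    proof (rule square_values_on_polynomial[OF sqf deg E, where x = x and t = t])
      fix I assume I: "I \<subseteq> {i \<in> A. t i mod m = b}" "card I = Polynomial.degree f + 2"
      define S where "S = (\<Sum>i\<in>I. t i * cofactor I x i)"
      have fin: "finite I"
        using I by (intro card_ge_0_finite) auto
      have IA: "i \<in> A" if "i \<in> I" for i
        using I that by auto
      have tt: "K * g dvd t i - t j" if "i \<in> I" "j \<in> I" for i j
      proof -
        have "t i mod m = b" "t j mod m = b"
          using I(1) that by auto
        then have "m dvd t i - t j"
          unfolding mod_eq_dvd_iff[symmetric] by simp
        then show ?thesis
          by (simp add: m_def)
      qed
      have xt: "\<forall>i\<in>I. g ^ n dvd x i \<and> t i ^ 2 = E * poly f (x i)"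
        using IA t xdvd by simp
      have "g ^ (n * ((D + 1) * (D + 2))) dvd S * C"
        unfolding S_def using I(2) tt
        by (intro dvdS[OF nk(1) _ inj Edvd xt]) (simp_all add: D_def)
      moreover have "(D + 1) * (D + 2) = e + 1"
        by (simp add: e_def power2_eq_square)
      ultimately have Sdvd: "g ^ (n * (e + 1)) dvd S * C"
        by (simp only:)
      have "\<bar>S\<bar> \<le> int (D + 2) * F * (g ^ N) ^ e"
        unfolding S_def e_def
      proof (rule abs_sum_cofactor_le[OF fin])
        show "card I = D + 2"
          using I(2) by (simp add: D_def)
        show "0 \<le> g ^ N"
          using g by simp
      qed (use x_le tle IA F in simp_all)
      then have "\<bar>S\<bar> * \<bar>C\<bar> \<le> int (D + 2) * F * (g ^ N) ^ e * \<bar>C\<bar>"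
        by (rule mult_right_mono) simp
      then have Sle: "\<bar>S * C\<bar> \<le> C' * g ^ (N * e)"
        by (simp only: abs_mult C'_def power_mult ac_simps)
      show "S = 0"
      proof (rule ccontr)
        assume "S \<noteq> 0"
        then have "S * C \<noteq> 0"
          using CK by simp
        then have "\<bar>g ^ (n * (e + 1))\<bar> \<le> \<bar>S * C\<bar>"
          using Sdvd by (rule dvd_imp_le_int)
        with Sle have le: "g ^ (n * (e + 1)) \<le> C' * g ^ (N * e)"
          by linarith
        \<comment> \<open>The inequality is squared so that the window condition applies without
          half-integral exponents.\<close>
        have "n + (2 * e + 1) * n = n * (e + 1) * 2"
          by (simp add: algebra_simps)
        then have "g ^ n * g ^ ((2 * e + 1) * n) = (g ^ (n * (e + 1))) ^ 2"
          by (simp only: power_add[symmetric] power_mult[symmetric])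
        also have "\<dots> \<le> (C' * g ^ (N * e)) ^ 2"
          using g by (intro power_mono[OF le] zero_le_power) simp
        also have "\<dots> = C' ^ 2 * g ^ (N * e * 2)"
          by (simp only: power_mult_distrib power_mult[symmetric])
        also have "\<dots> \<le> C' ^ 2 * g ^ ((2 * e + 1) * n)"
        proof (rule mult_left_mono[OF power_increasing])
          show "N * e * 2 \<le> (2 * e + 1) * n"
            using gap by (simp only: ac_simps)
        qed (use g in simp_all)
        finally have "g ^ n \<le> C' ^ 2"
          by (rule mult_right_le_imp_le) (use g in simp)
        then show False
          using gn nk(2) by linarith
      qed
    qed (use A inj t in auto)
    then have "card A \<le> card {0..<m} * (2 * D + 1)"
      using m by (intro card_le_of_fibres[where h = "\<lambda>i. t i mod m"]) auto
    then show ?thesis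
      by simp
  qed auto
  show ?thesis
  proof (intro exI conjI allI impI)
    show "e > 0"
      by (simp add: e_def)
    fix A
    assume "finite A" "\<forall>i\<in>A. k' \<le> i" "\<forall>i\<in>A. \<forall>j\<in>A. 2 * e * i \<le> (2 * e + 1) * j"
      "\<forall>i\<in>A. \<forall>j\<in>A. \<exists>t. poly f (g ^ i) * poly f (g ^ j) = t\<^sup>2"
    then show "card A \<le> nat m * (2 * D + 1)"
      by (intro bound) simp_all
  qed
qed

section \<open>Removing a factor \<open>X\<close>\<close>

text \<open>If \<open>h\<close> vanished at 0, then 0 would be a double root of
  \<open>X * h\<close>; and every double root of \<open>h\<close> is one of
  \<open>X * h\<close>.\<close>

lemma rsquarefree_factor_X:
  fixes h :: "int poly"
  assumes "Polynomial.rsquarefree (map_poly of_int (pCons 0 h) :: complex poly)"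
  shows "poly h 0 \<noteq> 0" "Polynomial.rsquarefree (map_poly of_int h :: complex poly)"
proof -
  define H where "H = (map_poly of_int h :: complex poly)"
  have sqf: "\<not> (z * poly H z = 0 \<and> poly H z + z * poly (Polynomial.pderiv H) z = 0)" for z
    using assms unfolding rsquarefree_roots by (simp add: map_poly_pCons pderiv_pCons flip: H_def)
  have "poly H 0 \<noteq> 0"
    using sqf[of 0] by simp
  then show "poly h 0 \<noteq> 0"
    using poly_map_of_int[of h 0, where 'a = complex] by (simp add: H_def)
  show "Polynomial.rsquarefree (map_poly of_int h :: complex poly)"
    unfolding rsquarefree_roots H_def[symmetric]
  proof
    fix z
    show "\<not> (poly H z = 0 \<and> poly (Polynomial.pderiv H) z = 0)"
      using sqf[of z] by auto
  qed
qed

lemma square_products_bounded: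
  fixes g :: int and f :: "int poly"
  assumes g: "g > 1" and deg: "Polynomial.degree f \<ge> 2"
    and sqf: "Polynomial.rsquarefree (map_poly of_int f :: complex poly)"
  shows "\<exists>B k c. c > 1 \<and> (\<forall>A. finite A \<longrightarrow> (\<forall>i\<in>A. i \<ge> k) \<longrightarrow> (\<forall>i\<in>A. \<forall>j\<in>A. real i \<le> c * real j) \<longrightarrow>
    (\<forall>i\<in>A. \<forall>j\<in>A. \<exists>t. poly f (g ^ i) * poly f (g ^ j) = t ^ 2) \<longrightarrow> card A \<le> B)"
proof -
  obtain a h where f: "f = pCons a h"
    by (cases f)
  \<comment> \<open>If \<open>f(0) = 0\<close>, the factor \<open>X\<close> is split off; for indices of equal parity it only contributes squares.\<close>
  define q where "q = (if a = 0 then h else f)"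
  \<comment> \<open>Degree at least 2 of \<open>f\<close> leaves degree at least 1 after
    \<open>X\<close> is removed.\<close>
  have q: "poly q 0 \<noteq> 0" "Polynomial.degree q \<ge> 1" "Polynomial.rsquarefree (map_poly of_int q :: complex poly)"
    using rsquarefree_factor_X[of h] deg sqf f by (auto simp: q_def split: if_splits)
  obtain B k e where e: "e > (0::nat)" and "\<forall>A. finite A \<longrightarrow> (\<forall>i\<in>A. i \<ge> k) \<longrightarrow>
    (\<forall>i\<in>A. \<forall>j\<in>A. 2 * e * i \<le> (2 * e + 1) * j) \<longrightarrow>
    (\<forall>i\<in>A. \<forall>j\<in>A. \<exists>t. poly q (g ^ i) * poly q (g ^ j) = t ^ 2) \<longrightarrow> card A \<le> B"
    using square_products_bounded_nonzero[OF g q] by (elim exE conjE) (rule that)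
  then have bound: "card A \<le> B" if "finite A" "\<And>i. i \<in> A \<Longrightarrow> i \<ge> k"
      "\<And>i j. i \<in> A \<Longrightarrow> j \<in> A \<Longrightarrow> 2 * e * i \<le> (2 * e + 1) * j"
      "\<And>i j. i \<in> A \<Longrightarrow> j \<in> A \<Longrightarrow> \<exists>t. poly q (g ^ i) * poly q (g ^ j) = t ^ 2" for A
    using that by simp
  define c where "c = 1 + 1 / (2 * real e)"
  have main: "card A \<le> card {0, 1 :: nat} * B"
    if A: "finite A" "\<And>i. i \<in> A \<Longrightarrow> i \<ge> k" "\<And>i j. i \<in> A \<Longrightarrow> j \<in> A \<Longrightarrow> real i \<le> c * real j"
      and sq: "\<And>i j. i \<in> A \<Longrightarrow> j \<in> A \<Longrightarrow> \<exists>t. poly f (g ^ i) * poly f (g ^ j) = t ^ 2" for A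
  proof (rule card_le_of_fibres)
    fix b :: nat
    show "card {i \<in> A. i mod 2 = b} \<le> B"
    proof (rule bound)
      fix i j assume ij: "i \<in> {i \<in> A. i mod 2 = b}" "j \<in> {i \<in> A. i mod 2 = b}"
      then have "real i \<le> c * real j"
        by (auto intro: A)
      then have "2 * real e * real i \<le> 2 * real e * (c * real j)"
        by (rule mult_left_mono) simp
      also have "\<dots> = (2 * real e + 1) * real j"
        using e by (simp add: c_def field_simps)
      finally have "real (2 * e * i) \<le> real ((2 * e + 1) * j)"
        by (simp add: algebra_simps)
      then show "2 * e * i \<le> (2 * e + 1) * j"
        unfolding of_nat_le_iff .
      obtain t where t: "poly f (g ^ i) * poly f (g ^ j) = t ^ 2"
        using sq ij by blast
      show "\<exists>t. poly q (g ^ i) * poly q (g ^ j) = t ^ 2"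
      proof (cases "a = 0")
        case True
        have "i mod 2 = j mod 2"
          using ij by simp
        then have "even (i + j)"
          by presburger
        then obtain r where r: "i + j = r * 2"
          by (metis evenE mult.commute)
        have "t ^ 2 = g ^ (i + j) * (poly q (g ^ i) * poly q (g ^ j))"
          using t True by (simp add: f q_def power_add algebra_simps)
        then have t2: "t ^ 2 = (g ^ r) ^ 2 * (poly q (g ^ i) * poly q (g ^ j))"
          by (simp add: r power_mult)
        then have "(g ^ r) ^ 2 dvd t ^ 2"
          by simp
        then obtain v where "t = g ^ r * v"
          by (auto simp: pow_divides_pow_iff)
        then have "poly q (g ^ i) * poly q (g ^ j) = v ^ 2"
          using t2 g by (simp add: power_mult_distrib)
        then show ?thesis
          by blast
      qed (use t in \<open>auto simp: q_def\<close>)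
    qed (use A in auto)
  qed auto
  have "c > 1"
    using e by (simp add: c_def)
  with main show ?thesis
    by (intro exI[of _ "card {0, 1 :: nat} * B"] exI[of _ k] exI[of _ c]) simp
qed

section \<open>Counting indices in an interval\<close>

text \<open>Relative to \<open>m = max 1 (M + 1)\<close>, the least admissible index, all indices
  have ratio at most \<open>1 + N\<close>, whatever \<open>M\<close> is. Cutting this range at the
  powers of \<open>c\<close> leaves at most \<open>1 + log c (1 + N)\<close> windows.\<close>

lemma card_le_geometric_windows:
  fixes M :: int and N B :: nat and c :: real
  assumes c: "c > 1" and A: "\<And>n. n \<in> A \<Longrightarrow> n \<ge> 1 \<and> int n \<in> {M + 1..M + int N}"
    and W: "\<And>W. W \<subseteq> A \<Longrightarrow> (\<And>i j. i \<in> W \<Longrightarrow> j \<in> W \<Longrightarrow> real i \<le> c * real j) \<Longrightarrow> card W \<le> B"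
  shows "real (card A) \<le> (1 + ln (1 + real N) / ln c) * real B"
proof -
  define m where "m = max 1 (M + 1)"
  define h where "h = (\<lambda>n::nat. nat \<lfloor>log c (real n / real_of_int m)\<rfloor>)"
  define J where "J = nat \<lfloor>log c (1 + real N)\<rfloor>"
  have ge: "real n / m \<ge> 1" and le: "real n / m \<le> 1 + real N" if "n \<in> A" for n
  proof -
    have "m \<ge> 1" and 1: "m \<le> int n" and "int n \<le> m + int N"
      using A[OF that] by (auto simp: m_def)
    moreover have "int N * 1 \<le> int N * m"
      using \<open>m \<ge> 1\<close> by (rule mult_left_mono) simp
    ultimately have "int n \<le> m * (1 + int N)"
      by (simp add: algebra_simps)
    then have "real_of_int (int n) \<le> real_of_int (m * (1 + int N))"
      by (simp only: of_int_le_iff)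
    then show "real n / m \<le> 1 + real N"
      using \<open>m \<ge> 1\<close> by (simp add: field_simps)
    have "real_of_int m \<le> real_of_int (int n)"
      using 1 by (simp only: of_int_le_iff)
    then show "real n / m \<ge> 1"
      using \<open>m \<ge> 1\<close> by simp
  qed
  have "card A \<le> card {..J} * B"
  proof (rule card_le_of_fibres[where h = h])
    fix n assume "n \<in> A"
    then have "log c (real n / m) \<le> log c (1 + real N)"
      using c ge[of n] le[of n] by simp
    then show "h n \<in> {..J}"
      unfolding h_def J_def by (auto intro!: nat_mono floor_mono)
  next
    fix b
    show "card {n \<in> A. h n = b} \<le> B"
    proof (rule W)
      fix i j assume "i \<in> {n \<in> A. h n = b}" "j \<in> {n \<in> A. h n = b}"
      then have ij: "i \<in> A" "j \<in> A" "h i = h j"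
        by auto
      have pos: "log c (real i / m) \<ge> 0" "log c (real j / m) \<ge> 0"
        using ge[OF ij(1)] ge[OF ij(2)] c by (auto simp: zero_le_log_cancel_iff)
      then have "\<lfloor>log c (real i / m)\<rfloor> = \<lfloor>log c (real j / m)\<rfloor>"
        using ij(3) by (simp add: h_def eq_nat_nat_iff)
      then have "log c (real i / m) \<le> 1 + log c (real j / m)"
        by linarith
      also have "\<dots> = log c (c * (real j / m))"
        using c ge[OF ij(2)] by (subst log_mult) (auto simp: zero_less_divide_iff)
      finally have "real i / m \<le> c * (real j / m)"
        using c ge[OF ij(1)] mult_pos_pos[of c "real j / m"] ge[OF ij(2)]
        by (subst (asm) log_le_cancel_iff) linarith+
      then show "real i \<le> c * real j"
        by (simp add: m_def divide_le_cancel split: if_splits)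
    qed auto
  qed auto
  then have "real (card A) \<le> real (card {..J} * B)"
    by (simp only: of_nat_le_iff)
  also have "\<dots> \<le> (1 + ln (1 + real N) / ln c) * real B"
  proof -
    have "log c (1 + real N) \<ge> 0"
      using c by simp
    then have "real J \<le> log c (1 + real N)"
      by (simp add: J_def)
    then have "real J \<le> ln (1 + real N) / ln c"
      by (simp add: log_def)
    then have "(1 + real J) * real B \<le> (1 + ln (1 + real N) / ln c) * real B"
      by (intro mult_right_mono) auto
    then show ?thesis
      by (simp add: algebra_simps)
  qed
  finally show ?thesis .
qed

section \<open>From equal quadratic fields to square products\<close>

text \<open>Write the root of \<open>a\<close> as \<open>p + q * y\<close> with \<open>y\<close> the
  root of \<open>b\<close>. If \<open>y\<close> is irrational, squaring forces
  \<open>p * q = 0\<close>, while \<open>q = 0\<close> would make both roots rational. So the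
  product of the roots is rational in every case; as an algebraic integer it is an integer.\<close>

lemma quad_field_eq_imp_square:
  assumes "a > 0" "b > 0" "quad_field a = quad_field b"
  shows "\<exists>t. a * b = t ^ 2"
proof -
  define x y where "x = csqrt (of_int a)" and "y = csqrt (of_int b)"
  have x2: "x * x = of_int a" and y2: "y * y = of_int b"
    unfolding x_def y_def by (simp_all flip: power2_eq_square)
  have "x \<in> quad_field a" "y \<in> quad_field b"
    unfolding quad_field_eq x_def y_def using Rats_0 Rats_1 by (metis (mono_tags, lifting) add_0 mem_Collect_eq mult_1)+
  then obtain p q p' q' where x: "x = p + q * y" "p \<in> \<rat>" "q \<in> \<rat>"
    and y: "y = p' + q' * x" "p' \<in> \<rat>" "q' \<in> \<rat>"
    using assms(3) unfolding quad_field_eq x_def y_def by blast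
  have "x * y \<in> \<rat>"
  proof (cases "y \<in> \<rat>")
    case True
    then show ?thesis
      using x by simp
  next
    case False
    have pq: "p * q = 0"
    proof (rule ccontr)
      assume nz: "p * q \<noteq> 0"
      have "of_int a = p * p + q * q * of_int b + 2 * (p * q) * y"
        unfolding x2[symmetric] y2[symmetric] by (simp add: x(1) algebra_simps)
      then have "y = (of_int a - p * p - q * q * of_int b) / (2 * (p * q))"
        using nz by (simp add: field_simps)
      moreover have "(of_int a - p * p - q * q * of_int b) / (2 * (p * q)) \<in> \<rat>"
        using x by (intro Rats_divide Rats_diff Rats_mult) auto
      ultimately show False
        using False by simp
    qed
    have "q \<noteq> 0"
    proof
      assume "q = 0"
      then have "x \<in> \<rat>"
        unfolding x(1) using x(2) by simp
      then have "p' + q' * x \<in> \<rat>"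
        using y(2,3) by simp
      then show False
        using False unfolding y(1)[symmetric] by contradiction
    qed
    with pq have "x * y = q * of_int b"
      using x(1) by (simp flip: y2)
    then show ?thesis
      using x by simp
  qed
  moreover have "algebraic_int (x * y)"
  proof (rule algebraic_int_root)
    show "poly (Polynomial.monom 1 2) (x * y) = of_int (a * b)"
      by (simp add: poly_monom power2_eq_square x2 y2 mult.assoc mult.left_commute)
    show "algebraic_int (of_int (a * b) :: complex)"
      by (rule int_imp_algebraic_int) simp
  qed (auto simp: degree_monom_eq)
  ultimately have "x * y \<in> \<int>"
    by (intro rational_algebraic_int_is_int)
  then obtain t where "x * y = of_int t"
    by (elim Ints_cases)
  then have "complex_of_int (a * b) = of_int (t ^ 2)"
    by (metis (no_types, lifting) mult.assoc mult.commute of_int_mult power2_eq_square x2 y2)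
  then show ?thesis
    by (metis of_int_eq_iff)
qed

lemma poly_power_eventually_pos:
  fixes g :: int and f :: "int poly"
  assumes "g > 1" "Polynomial.lead_coeff f > 0"
  shows "\<exists>k. \<forall>n\<ge>k. poly f (g ^ n) > 0"
proof -
  define F where "F = (map_poly of_int f :: real poly)"
  have "Polynomial.lead_coeff F > 0"
    using assms by (simp add: F_def degree_map_poly coeff_map_poly)
  then obtain r where r: "\<And>x. x \<ge> r \<Longrightarrow> poly F x \<ge> Polynomial.lead_coeff F"
    using poly_pinfty_gt_lc by blast
  have "poly f (g ^ n) > 0" if "n \<ge> nat \<lceil>r\<rceil>" for n
  proof -
    have "int n < 2 ^ n"
      by (metis of_nat_less_two_power)
    also have "2 ^ n \<le> g ^ n"
      using assms by (intro power_mono) auto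
    finally have "real_of_int (int n) \<le> real_of_int (g ^ n)"
      unfolding of_int_le_iff by simp
    then have "real_of_int (g ^ n) \<ge> r"
      using that by linarith
    then have "poly F (real_of_int (g ^ n)) > 0"
      using r \<open>Polynomial.lead_coeff F > 0\<close> by fastforce
    then show ?thesis
      by (simp only: F_def poly_map_of_int of_int_0_less_iff)
  qed
  then show ?thesis
    by blast
qed

text \<open>Eliminates \<open>s\<close>, so that the count of indices becomes uniform in it:
  \<open>s ^ 2\<close> divides \<open>(t * u) ^ 2\<close>, hence \<open>s\<close> divides
  \<open>t * u\<close>.\<close>

lemma square_product_cancel:
  fixes a b s :: int
  assumes "s \<noteq> 0" "a * s = t ^ 2" "b * s = u ^ 2"
  shows "\<exists>v. a * b = v ^ 2"
proof -
  have eq: "(t * u) ^ 2 = s ^ 2 * (a * b)"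
    by (simp add: power_mult_distrib flip: assms) (simp add: power2_eq_square)
  then have "s ^ 2 dvd (t * u) ^ 2"
    by simp
  then obtain v where "t * u = s * v"
    by (auto simp: pow_divides_pow_iff)
  then have "a * b = v ^ 2"
    using eq assms(1) by (simp add: power_mult_distrib)
  then show ?thesis
    by blast
qed

text \<open>Uniformity in \<open>M\<close> and \<open>s\<close> holds because the products of pairs
  of values do not involve \<open>s\<close>, and the number of windows depends only on
  \<open>N\<close> and the fixed ratio \<open>c\<close>.\<close>

lemma Q_count_le_log:
  fixes g :: int and f :: "int poly"
  assumes g: "g > 1" and deg: "Polynomial.degree f \<ge> 2" and lc: "Polynomial.lead_coeff f > 0"
    and sqf: "Polynomial.rsquarefree (map_poly of_int f :: complex poly)"
  shows "\<exists>K>0. \<forall>M N s. s \<ge> 1 \<longrightarrow> real (Q_count (\<lambda>n. poly f (g ^ n)) M N s) \<le> K * (1 + ln (1 + real N))"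
proof -
  obtain B k1 c where c: "c > 1" and "\<forall>A. finite A \<longrightarrow> (\<forall>i\<in>A. i \<ge> k1) \<longrightarrow>
    (\<forall>i\<in>A. \<forall>j\<in>A. real i \<le> c * real j) \<longrightarrow>
    (\<forall>i\<in>A. \<forall>j\<in>A. \<exists>t. poly f (g ^ i) * poly f (g ^ j) = t ^ 2) \<longrightarrow> card A \<le> B"
    using square_products_bounded[OF g deg sqf] by (elim exE conjE) (rule that)
  then have bound: "card A \<le> B" if "finite A" "\<And>i. i \<in> A \<Longrightarrow> i \<ge> k1"
      "\<And>i j. i \<in> A \<Longrightarrow> j \<in> A \<Longrightarrow> real i \<le> c * real j"
      "\<And>i j. i \<in> A \<Longrightarrow> j \<in> A \<Longrightarrow> \<exists>t. poly f (g ^ i) * poly f (g ^ j) = t ^ 2" for A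
    using that by simp
  obtain k2 where k2: "\<And>n. n \<ge> k2 \<Longrightarrow> poly f (g ^ n) > 0"
    using poly_power_eventually_pos[OF g lc] by blast
  \<comment> \<open>From \<open>k1\<close> on the window bound applies, from \<open>k2\<close> on
    the values are positive; indices below \<open>k\<close> are counted trivially.\<close>
  define k where "k = max k1 k2"
  \<comment> \<open>\<open>K\<close> dominates both \<open>k + B\<close> and
    \<open>B / ln c\<close>; the added 1 makes it positive.\<close>
  define K where "K = real k + real B + real B / ln c + 1"
  have lnc: "ln c > 0"
    using c by simp
  have "real (Q_count (\<lambda>n. poly f (g ^ n)) M N s) \<le> K * (1 + ln (1 + real N))" if s: "s \<ge> 1" for M N s
  proof -
    define A where "A = {n::nat. n \<ge> 1 \<and> int n \<in> {M + 1..M + int N} \<and> quad_field (poly f (g ^ n)) = quad_field s}"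
    define A' where "A' = {n \<in> A. n \<ge> k}"
    have "A \<subseteq> {..nat (M + int N)}"
      by (auto simp: A_def)
    then have "finite A"
      by (rule finite_subset) simp
    then have fin: "finite A'"
      by (simp add: A'_def)
    have sq: "\<exists>t. poly f (g ^ n) * s = t ^ 2" if "n \<in> A'" for n
      using that k2[of n] s by (intro quad_field_eq_imp_square) (auto simp: A'_def A_def k_def)
    have "real (card A') \<le> (1 + ln (1 + real N) / ln c) * real B"
    proof (rule card_le_geometric_windows[OF c])
      fix W assume W: "W \<subseteq> A'" "\<And>i j. i \<in> W \<Longrightarrow> j \<in> W \<Longrightarrow> real i \<le> c * real j"
      show "card W \<le> B"
      proof (rule bound[OF _ _ W(2)])
        fix i j assume "i \<in> W" "j \<in> W"
        then show "\<exists>t. poly f (g ^ i) * poly f (g ^ j) = t ^ 2"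
          using sq[of i] sq[of j] W(1) s square_product_cancel[of s] by fastforce
      qed (use W(1) fin in \<open>auto simp: A'_def k_def intro: finite_subset\<close>)
    qed (auto simp: A'_def A_def)
    moreover have "card A \<le> k + card A'"
    proof -
      have "A \<subseteq> {..<k} \<union> A'"
        by (auto simp: A'_def)
      then have "card A \<le> card ({..<k} \<union> A')"
        using fin by (intro card_mono) auto
      also have "\<dots> \<le> card {..<k} + card A'"
        by (rule card_Un_le)
      finally show ?thesis
        by simp
    qed
    ultimately have "real (card A) \<le> real k + real B + real B / ln c * ln (1 + real N)"
      by (simp add: algebra_simps)
    also have "\<dots> \<le> K * 1 + K * ln (1 + real N)"
      using lnc by (intro add_mono mult_right_mono) (auto simp: K_def)
    finally show ?thesis
      by (simp add: Q_count_def A_def distrib_left)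
  qed
  moreover have "K > 0"
    using lnc by (simp add: K_def add_nonneg_pos)
  ultimately show ?thesis
    by blast
qed

section \<open>Summation over \<open>s\<close>\<close>

lemma Q_count_le_length: "Q_count u M N s \<le> N"
proof -
  have "Q_count u M N s \<le> card {M + 1..M + int N}"
    unfolding Q_count_def by (rule card_inj_on_le[of int]) auto
  then show ?thesis
    by simp
qed

lemma Q_total_le:
  assumes "\<And>s. s \<ge> 1 \<Longrightarrow> real (Q_count u M N s) \<le> b" "b \<ge> 0"
  shows "real (Q_total u M N S) \<le> real S * b"
proof -
  have "real (Q_total u M N S) \<le> (\<Sum>s | s \<in> {1..int S} \<and> squarefree s. b)"
    unfolding Q_total_def of_nat_sum by (intro sum_mono assms) auto
  also have "\<dots> = real (card {s. s \<in> {1..int S} \<and> squarefree s}) * b"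
    by simp
  also have "\<dots> \<le> real (card {1..int S}) * b"
    using assms(2) by (intro mult_right_mono of_nat_mono card_mono) auto
  finally show ?thesis
    by simp
qed

theorem theorem1p2:
  fixes g :: int and f :: "int poly" and \<alpha> :: real
  assumes "g > 1"
    and "Polynomial.degree f \<ge> 3"
    and "Polynomial.lead_coeff f > 0"
    and "Polynomial.rsquarefree (map_poly of_int f :: complex poly)"
    and "\<alpha> > 0"
    and "\<exists>c>0. \<forall>\<^sub>F z :: real in at_top.
           z / ln z \<le> c * real (card {l :: nat. real l \<le> z \<and> Factorial_Ring.prime l \<and> l > 2
                                        \<and> real (largest_prime_factor (l - 1)) \<ge> real l powr \<alpha>})"
  shows "\<exists>\<epsilon> :: nat \<Rightarrow> real. \<epsilon> \<longlonglongrightarrow> 0 \<and>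
           (\<forall>(M :: int) (N :: nat) (S :: nat). N \<ge> 1 \<longrightarrow> S \<ge> 1 \<longrightarrow>
              real (Q_total (\<lambda>n. poly f (g ^ n)) M N S)
                \<le> (real S * real N powr (1 / (1 + \<alpha>))
                    + real S powr (1 - 1 / (4 * \<alpha>)) * real N powr (1 / (2 * \<alpha>)))
                  * real N powr \<epsilon> N)"
proof -
  obtain K where K: "K > 0" and bound: "\<And>M N s. s \<ge> 1 \<Longrightarrow>
      real (Q_count (\<lambda>n. poly f (g ^ n)) M N s) \<le> K * (1 + ln (1 + real N))"
    using Q_count_le_log[of g f] assms(1-4) by auto
  \<comment> \<open>Chosen so that \<open>real N powr \<epsilon> N\<close> equals
    \<open>K * (1 + ln (1 + real N))\<close> for \<open>N > 1\<close>.\<close>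
  define \<epsilon> where "\<epsilon> = (\<lambda>N::nat. ln (K * (1 + ln (1 + real N))) / ln (real N))"
  have "\<epsilon> \<longlonglongrightarrow> 0"
    unfolding \<epsilon>_def using K by real_asymp
  moreover have "real (Q_total (\<lambda>n. poly f (g ^ n)) M N S)
      \<le> (real S * real N powr (1 / (1 + \<alpha>)) + real S powr (1 - 1 / (4 * \<alpha>)) * real N powr (1 / (2 * \<alpha>)))
        * real N powr \<epsilon> N" if N: "N \<ge> 1" for M N S
  proof -
    have Q: "real (Q_count (\<lambda>n. poly f (g ^ n)) M N s) \<le> real N powr \<epsilon> N" if "s \<ge> 1" for s
    \<comment> \<open>For \<open>N = 1\<close> every power of \<open>N\<close> is 1, whatever the
      exponent, and the trivial bound by the length \<open>N\<close> takes over.\<close>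
    proof (cases "N = 1")
      case True
      then show ?thesis
        using Q_count_le_length[of "\<lambda>n. poly f (g ^ n)" M N s] by simp
    next
      case False
      then have "N > 1" "ln (1 + real N) \<ge> 0"
        using N by auto
      then have "real N powr \<epsilon> N = K * (1 + ln (1 + real N))"
        using K by (simp add: powr_def \<epsilon>_def add_pos_nonneg)
      then show ?thesis
        using bound[OF that] by simp
    qed
    \<comment> \<open>Arranged for comparison term by term: 1 is at most
      \<open>real N powr (1 / (1 + \<alpha>))\<close>, and 0 is at most the second summand.\<close>
    have "real (Q_total (\<lambda>n. poly f (g ^ n)) M N S) \<le> (real S * 1 + 0) * real N powr \<epsilon> N"
      using Q_total_le[OF Q] by simp
    also have "\<dots> \<le> (real S * real N powr (1 / (1 + \<alpha>))
        + real S powr (1 - 1 / (4 * \<alpha>)) * real N powr (1 / (2 * \<alpha>))) * real N powr \<epsilon> N"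
      using N assms(5) by (intro mult_right_mono add_mono mult_left_mono ge_one_powr_ge_zero) auto
    finally show ?thesis .
  qed
  ultimately show ?thesis
    by blast
qed

end
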